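(* Let $F\in\mathcal F_1(I)$ be strictly decreasing, let $c_i\in J(F)$ satisfy $J(F)\cap F(c_i)=\{c_i\}$, suppose that the set $F(c_i)$ is a compact interval, let $k\ge1$ be an odd integer, and let $\hat f$ be a strictly decreasing continuous (single-valued) iterative root of order $k$ of $F$ on $I\setminus J(F)$. If $$J(F)\cap\left(\lim_{x\to c_i+}\hat f(x),\ \lim_{x\to c_i-}\hat f(x)\right)=\{c_i\},$$ then the multifunction $$f(x):=\begin{cases}\hat f(x), & x\in I\setminus J(F),\\ \left[\lim_{s\to c_i+}\hat f(s),\ \lim_{s\to c_i-}\hat f(s)\right], & x=c_i,\end{cases}$$ is a strictly decreasing usc iterative root of order $k$ of $F$ on $(I\setminus J(F))\cup\{c_i\}$.
   Context: Let $I=[a,b]\subset\mathbb R$, $a<b$. A multifunction $F:I\to 2^I$ assigns to each $x\in I$ a nonempty subset $F(x)\subset I$ (singletons are identified with their elements); $F(A)=\bigcup_{x\in A}F(x)$, $(G\circ F)(x)=G(F(x))$, $F^0(x)=\{x\}$, $F^n=F\circ F^{n-1}$. $F$ is upper semi-continuous (usc) at $x_0$ if for every open $V\subset\mathbb R$ with $F(x_0)\subset V$ there is a neighborhood $U$ of $x_0$ such that $F(x)\subset V$ for all $x\in U$ in the domain; usc means usc at every point. $F$ is strictly increasing (resp. strictly decreasing) if $\max F(x)<\min F(y)$ (resp. $\min F(x)>\max F(y)$) whenever $x<y$ in the domain; strictly monotone means one of these. $\mathcal F(I)$ is the class of strictly monotone usc multifunctions $I\to 2^I$. A jump of $F$ is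 a point $x_0\in I$ with $\#F(x_0)\ge 2$; $J(F)$ is the set of jumps. For $F\in\mathcal F(I)$ with finitely many jumps, the intensity $\zeta(F)$ is the least integer $k\ge 0$ with $\#J(F^k)=\#J(F^{k+1})$ (and $+\infty$ if there is none). $\mathcal F_1(I)$ is the set of $F\in\mathcal F(I)$ with finitely many jumps and $\zeta(F)=1$. For $F\in\mathcal F_1(I)$ write $J(F)=\{c_1,\dots,c_m\}$ with the standing convention $a<c_1<\dots<c_m<b$; $F$ is single-valued on $I\setminus J(F)$ and maps this set into itself. For $D\subset I$, an iterative root of $F$ of order $k$ on $D$ is a (multi)function $f$ from $D$ to nonempty subsets of $D$ with $f^k(x)=F(x)$ for all $x\in D$. *)

theory Defs
  imports "HOL-Analysis.Analysis" "HOL-Library.Extended_Nat"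
begin

text \<open>A multifunction on \<open>D\<close> is a total function \<open>real \<Rightarrow> real set\<close> of which only the
  values at points of \<open>D\<close> matter; a single-valued \<open>g\<close> is identified with \<open>\<lambda>x. {g x}\<close>.\<close>

definition multifun_on :: "real set \<Rightarrow> (real \<Rightarrow> real set) \<Rightarrow> bool" where
  "multifun_on D F \<longleftrightarrow> (\<forall>x\<in>D. F x \<noteq> {} \<and> F x \<subseteq> D)"

primrec mf_iter :: "(real \<Rightarrow> real set) \<Rightarrow> nat \<Rightarrow> real \<Rightarrow> real set" where
  "mf_iter F 0 x = {x}"
| "mf_iter F (Suc n) x = (\<Union>y\<in>mf_iter F n x. F y)"

definition usc_on :: "real set \<Rightarrow> (real \<Rightarrow> real set) \<Rightarrow> bool" where
  "usc_on D F \<longleftrightarrow>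
     (\<forall>x0\<in>D. \<forall>V. open V \<and> F x0 \<subseteq> V \<longrightarrow>
        (\<exists>U. open U \<and> x0 \<in> U \<and> (\<forall>x\<in>U \<inter> D. F x \<subseteq> V)))"

definition is_max :: "real set \<Rightarrow> real \<Rightarrow> bool" where
  "is_max S M \<longleftrightarrow> M \<in> S \<and> (\<forall>s\<in>S. s \<le> M)"

definition is_min :: "real set \<Rightarrow> real \<Rightarrow> bool" where
  "is_min S m \<longleftrightarrow> m \<in> S \<and> (\<forall>s\<in>S. m \<le> s)"

text \<open>The inequalities between maxima and minima include the existence of the
  maxima and minima that occur in them.\<close>

definition mf_strict_inc_on :: "real set \<Rightarrow> (real \<Rightarrow> real set) \<Rightarrow> bool" where
  "mf_strict_inc_on D F \<longleftrightarrow>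
     (\<forall>x\<in>D. \<forall>y\<in>D. x < y \<longrightarrow> (\<exists>M m. is_max (F x) M \<and> is_min (F y) m \<and> M < m))"

definition mf_strict_dec_on :: "real set \<Rightarrow> (real \<Rightarrow> real set) \<Rightarrow> bool" where
  "mf_strict_dec_on D F \<longleftrightarrow>
     (\<forall>x\<in>D. \<forall>y\<in>D. x < y \<longrightarrow> (\<exists>m M. is_min (F x) m \<and> is_max (F y) M \<and> m > M))"

definition strict_mono_usc :: "real set \<Rightarrow> (real \<Rightarrow> real set) set" where
  "strict_mono_usc I =
     {F. multifun_on I F \<and> (mf_strict_inc_on I F \<or> mf_strict_dec_on I F) \<and> usc_on I F}"

text \<open>\<open>#F(x) \<ge> 2\<close> is spelled out because \<open>card\<close> is \<open>0\<close> on infinite sets.\<close>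

definition jumps :: "real set \<Rightarrow> (real \<Rightarrow> real set) \<Rightarrow> real set" where
  "jumps I F = {x\<in>I. \<exists>u\<in>F x. \<exists>v\<in>F x. u \<noteq> v}"

text \<open>Meaningful for \<open>F \<in> strict_mono_usc I\<close> with finitely many jumps: values at distinct
  points are then disjoint, so the jump sets of all iterates are finite and \<open>card\<close>
  is the true cardinality.\<close>

definition intensity :: "real set \<Rightarrow> (real \<Rightarrow> real set) \<Rightarrow> enat" where
  "intensity I F =
     (if \<exists>k. card (jumps I (mf_iter F k)) = card (jumps I (mf_iter F (Suc k)))
      then enat (LEAST k. card (jumps I (mf_iter F k)) = card (jumps I (mf_iter F (Suc k))))
      else \<infinity>)"

definition intensity_one :: "real set \<Rightarrow> (real \<Rightarrow> real set) set" where
  "intensity_one I = {F \<in> strict_mono_usc I. finite (jumps I F) \<and> intensity I F = 1}"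

definition iter_root_on ::
    "real set \<Rightarrow> nat \<Rightarrow> (real \<Rightarrow> real set) \<Rightarrow> (real \<Rightarrow> real set) \<Rightarrow> bool" where
  "iter_root_on D k F f \<longleftrightarrow> multifun_on D f \<and> (\<forall>x\<in>D. mf_iter f k x = F x)"

end

theory Submission imports Defs begin

(* The only possible obstruction is a jump of F at an endpoint of f c = [p, q].  But fh maps
   points left of c to the right of q > c and points right of c to the left of p < c, so for odd k
   the limit max (F c) of the k-th iterate of fh from the left is at least q, and likewise
   min (F c) is at most p.  Hence [p, q] lies in F c and contains no jump but c.  The sets f^j c
   are then intervals whose endpoints are iterates of p and q; they increase with j, and the k-th
   one is F c by continuity of fh at p and q, so that no jump other than c is ever met. *)

text \<open>The limit is the infimum of the values of \<open>h\<close> at points of \<open>S\<close>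
  left of \<open>c\<close>. It is not attained: between any such point and \<open>c\<close> there is
  another point of \<open>S\<close>, where \<open>h\<close> is smaller still. \<open>S\<close> has
  to fill a left neighbourhood of \<open>c\<close> only, so it may have gaps elsewhere.\<close>

lemma strict_antimono_on_left_limit:
  fixes h :: "real \<Rightarrow> real"
  assumes anti: "strict_antimono_on S h" and S: "eventually (\<lambda>x. x \<in> S) (at_left c)"
    and bnd: "bdd_below (h ` S)"
  obtains l where "(h \<longlongrightarrow> l) (at_left c)" and "\<And>x. x \<in> S \<Longrightarrow> x < c \<Longrightarrow> l < h x"
proof -
  obtain d where d: "d < c" "\<And>x. d < x \<Longrightarrow> x < c \<Longrightarrow> x \<in> S"
    using S by (auto simp: eventually_at_left_field)
  define T where "T = h ` (S \<inter> {..<c})"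
  define l where "l = Inf T"
  have "(d + c) / 2 \<in> S \<inter> {..<c}" using d by auto
  then have ne: "T \<noteq> {}" unfolding T_def by blast
  have bT: "bdd_below T" using bnd unfolding T_def by (rule bdd_below_mono) auto
  have less: "l < h x" if "x \<in> S" "x < c" for x
  proof -
    obtain y where y: "max x d < y" "y < c" using dense[of "max x d" c] \<open>x < c\<close> d by auto
    then have yS: "y \<in> S" using d by auto
    have "l \<le> h y" unfolding l_def by (rule cInf_lower[OF _ bT]) (use y yS in \<open>auto simp: T_def\<close>)
    also have "h y < h x" using monotone_onD[OF anti that(1) yS] y by auto
    finally show ?thesis .
  qed
  have "(h \<longlongrightarrow> l) (at_left c)"
  proof (rule order_tendstoI)
    fix e assume e: "e < l"
    have "eventually (\<lambda>x. x < c) (at_left c)" by (auto simp: eventually_at_filter)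
    then show "eventually (\<lambda>x. e < h x) (at_left c)"
      using S by eventually_elim (use e less in force)
  next
    fix e assume "l < e"
    then obtain y where y: "y \<in> S" "y < c" "h y < e"
      using cInf_lessD[OF ne, of e] unfolding l_def T_def by auto
    have "eventually (\<lambda>x. x \<in> {y<..<c}) (at_left c)"
      by (rule eventually_at_leftI[OF _ y(2)]) auto
    then show "eventually (\<lambda>x. h x < e) (at_left c)"
      using S
    proof eventually_elim
      case (elim x)
      then show ?case using monotone_onD[OF anti y(1), of x] y by auto
    qed
  qed
  then show thesis using that less by blast
qed

text \<open>The reflection \<open>\<lambda>x. - h (- x)\<close> is again strictly decreasing and
  exchanges the two sides, so the left-hand version at \<open>- c\<close> applies.\<close>

lemma strict_antimono_on_right_limit:
  fixes h :: "real \<Rightarrow> real"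
  assumes anti: "strict_antimono_on S h" and S: "eventually (\<lambda>x. x \<in> S) (at_right c)"
    and bnd: "bdd_above (h ` S)"
  obtains l where "(h \<longlongrightarrow> l) (at_right c)" and "\<And>x. x \<in> S \<Longrightarrow> c < x \<Longrightarrow> h x < l"
proof -
  have "strict_antimono_on (uminus ` S) (\<lambda>x. - h (- x))"
    using anti by (auto simp: monotone_on_def)
  moreover have "eventually (\<lambda>x. x \<in> uminus ` S) (at_left (- c))"
    using S unfolding at_right_minus[of c] by (auto simp: eventually_filtermap elim!: eventually_mono)
      (metis image_eqI minus_minus)
  moreover have "bdd_below ((\<lambda>x. - h (- x)) ` uminus ` S)"
    using bnd by (simp add: image_image bdd_below_uminus_image)
  ultimately obtain l where l: "((\<lambda>x. - h (- x)) \<longlongrightarrow> l) (at_left (- c))"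
    "\<And>x. x \<in> uminus ` S \<Longrightarrow> x < - c \<Longrightarrow> l < - h (- x)"
    using strict_antimono_on_left_limit by blast
  have "(h \<longlongrightarrow> - l) (at_right c)"
    using tendsto_minus[OF l(1)] unfolding at_right_minus[of c] by (simp add: filterlim_filtermap)
  moreover have "h x < - l" if "x \<in> S" "c < x" for x using l(2)[of "- x"] that by auto
  ultimately show thesis using that by blast
qed

lemma mf_iter_single_valued:
  assumes "\<And>x. x \<in> S \<Longrightarrow> f x = {h x}" and "\<And>x. x \<in> S \<Longrightarrow> h x \<in> S" and "x \<in> S"
  shows "mf_iter f n x = {(h ^^ n) x} \<and> (h ^^ n) x \<in> S"
  by (induction n) (use assms in auto)

lemma continuous_on_funpow:
  assumes "continuous_on S h" and "h ` S \<subseteq> S"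
  shows "continuous_on S (h ^^ n) \<and> (h ^^ n) ` S \<subseteq> S"
proof (induction n)
  case 0
  then show ?case by (simp add: id_def)
next
  case (Suc n)
  then have "continuous_on S (h \<circ> (h ^^ n))"
    by (intro continuous_on_compose) (auto intro: continuous_on_subset[OF assms(1)])
  then show ?case using Suc assms(2) by auto
qed

text \<open>A multifunction that is single-valued and continuous off \<open>c\<close> and fills its jump at \<open>c\<close>
  has the intermediate value property.\<close>

lemma decreasing_filled_jump_image:
  fixes h :: "real \<Rightarrow> real"
  assumes S: "{u..v} - {c} \<subseteq> S" and uv: "u < c" "c < v"
    and anti: "strict_antimono_on S h" and cont: "continuous_on S h"
    and q: "(h \<longlongrightarrow> q) (at_left c)" "\<And>x. x \<in> S \<Longrightarrow> x < c \<Longrightarrow> q < h x"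
    and p: "(h \<longlongrightarrow> p) (at_right c)" "\<And>x. x \<in> S \<Longrightarrow> c < x \<Longrightarrow> h x < p"
    and pq: "p < q"
    and f: "\<And>x. x \<in> S \<Longrightarrow> f x = {h x}" "c \<notin> S" "f c = {p..q}"
  shows "(\<Union>y\<in>{u..v}. f y) = {h v..h u}"
proof
  have uS: "u \<in> S" and vS: "v \<in> S" using S uv by auto
  have hu: "q < h u" and hv: "h v < p" using p q uS vS uv by auto
  have le: "h y \<le> h x" if "x \<in> S" "y \<in> S" "x \<le> y" for x y
    using monotone_onD[OF anti that(1,2)] that by (cases "x = y") auto
  show "(\<Union>y\<in>{u..v}. f y) \<subseteq> {h v..h u}"
  proof (intro UN_least)
    fix y assume y: "y \<in> {u..v}"
    show "f y \<subseteq> {h v..h u}"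
    proof (cases "y = c")
      case True
      then show ?thesis using f hu hv by auto
    next
      case False
      then have "y \<in> S" using y S by auto
      then show ?thesis using f le[OF uS \<open>y \<in> S\<close>] le[OF \<open>y \<in> S\<close> vS] y by auto
    qed
  qed
  show "{h v..h u} \<subseteq> (\<Union>y\<in>{u..v}. f y)"
  proof
    fix t assume t: "t \<in> {h v..h u}"
    \<comment> \<open>Values in the jump are taken at \<open>c\<close>. For \<open>t\<close> above
      \<open>q\<close>, the left limit yields \<open>x\<close> between \<open>u\<close> and
      \<open>c\<close> with \<open>h x < t\<close>, and the intermediate value theorem works on
      \<open>{u..x}\<close>, which avoids \<open>c\<close>; the case below \<open>p\<close> is
      symmetric.\<close>
    consider "t \<in> {p..q}" | "q < t" | "t < p" by force
    then show "t \<in> (\<Union>y\<in>{u..v}. f y)"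
    proof cases
      case 1
      then show ?thesis using f uv by (intro UN_I[of c]) auto
    next
      case 2
      have "eventually (\<lambda>x. h x < t) (at_left c)" using order_tendstoD(2)[OF q(1) 2] .
      moreover have "eventually (\<lambda>x. x \<in> {u<..<c}) (at_left c)"
        by (rule eventually_at_leftI[OF _ uv(1)]) auto
      ultimately have "eventually (\<lambda>x. h x < t \<and> x \<in> {u<..<c}) (at_left c)"
        by eventually_elim auto
      then obtain x where x: "h x < t" "u < x" "x < c"
        using eventually_happens'[OF trivial_limit_at_left_real] by auto
      have sub: "{u..x} \<subseteq> S" using S x uv by auto
      obtain y where "u \<le> y" "y \<le> x" "h y = t"
        using IVT2'[of h x t u] x t continuous_on_subset[OF cont sub] by auto
      then show ?thesis using f sub x uv by (intro UN_I[of y]) auto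
    next
      case 3
      have "eventually (\<lambda>x. t < h x) (at_right c)" using order_tendstoD(1)[OF p(1) 3] .
      moreover have "eventually (\<lambda>x. x \<in> {c<..<v}) (at_right c)"
        by (rule eventually_at_rightI[OF _ uv(2)]) auto
      ultimately have "eventually (\<lambda>x. t < h x \<and> x \<in> {c<..<v}) (at_right c)"
        by eventually_elim auto
      then obtain x where x: "t < h x" "c < x" "x < v"
        using eventually_happens'[OF trivial_limit_at_right_real] by auto
      have sub: "{x..v} \<subseteq> S" using S x uv by auto
      obtain y where "x \<le> y" "y \<le> v" "h y = t"
        using IVT2'[of h v t x] x t continuous_on_subset[OF cont sub] by auto
      then show ?thesis using f sub x uv by (intro UN_I[of y]) auto
    qed
  qed
qed

theorem corollary5p3:
  fixes a b c :: real and I J :: "real set" and k :: nat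
    and F f :: "real \<Rightarrow> real set" and fh :: "real \<Rightarrow> real"
  assumes "a < b" and "I = {a..b}"
    and "F \<in> intensity_one I"
    and "J = jumps I F"
    and "J \<subseteq> {a<..<b}"
    and "mf_strict_dec_on I F"
    and "c \<in> J" and "J \<inter> F c = {c}"
    and "compact (F c)" and "is_interval (F c)"
    and "k \<ge> 1" and "odd k"
    and "strict_antimono_on (I - J) fh" and "continuous_on (I - J) fh"
    and "iter_root_on (I - J) k F (\<lambda>x. {fh x})"
    and "J \<inter> {Lim (at_right c) fh <..< Lim (at_left c) fh} = {c}"
    and "\<And>x. x \<in> I - J \<Longrightarrow> f x = {fh x}"
    and "f c = {Lim (at_right c) fh .. Lim (at_left c) fh}"
  shows "mf_strict_dec_on ((I - J) \<union> {c}) f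
    \<and> usc_on ((I - J) \<union> {c}) f
    \<and> iter_root_on ((I - J) \<union> {c}) k F f"
proof -
  define S where "S = I - J"
  note anti = assms(13)[folded S_def] and cont = assms(14)[folded S_def]
    and fS = assms(17)[folded S_def]
  have uscF: "usc_on I F" and multF: "multifun_on I F" and finJ: "finite J"
    using assms(3,4) by (auto simp: intensity_one_def strict_mono_usc_def)
  have c: "a < c" "c < b" "c \<notin> S" "c \<in> I" using assms(2,5,7) by (auto simp: S_def)
  have inv: "fh x \<in> S" if "x \<in> S" for x
    using assms(15) that by (auto simp: iter_root_on_def multifun_on_def S_def)
  have iterS: "mf_iter f n x = {(fh ^^ n) x} \<and> (fh ^^ n) x \<in> S" if "x \<in> S" for n x
    by (rule mf_iter_single_valued[OF _ _ that]) (use fS inv in auto)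
  \<comment> \<open>The hypothesis on the root concerns \<open>\<lambda>x. {fh x}\<close>, which
    agrees with \<open>f\<close> only on \<open>S\<close>; hence a second use of the lemma on
    single-valued iterates.\<close>
  have FS: "F x = {(fh ^^ k) x}" if "x \<in> S" for x
    using assms(15) mf_iter_single_valued[of S "\<lambda>x. {fh x}" fh x k] inv that
    unfolding iter_root_on_def S_def by force
  have SI: "S \<subseteq> {a..b}" using assms(2) by (auto simp: S_def)

  \<comment> \<open>One-sided limits of \<open>fh\<close> at \<open>c\<close>\<close>
  have "open ({a<..<b} - (J - {c}))" using finJ by (intro open_Diff finite_imp_closed) auto
  then have "eventually (\<lambda>x. x \<in> {a<..<b} - (J - {c})) (nhds c)"
    using c by (intro eventually_nhds_in_open) auto
  \<comment> \<open>As there are finitely many jumps, \<open>c\<close> is isolated among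
    them.\<close>
  then have S_ev: "eventually (\<lambda>x. x \<in> S) (at c)"
    unfolding eventually_at_filter by eventually_elim (use assms(2) in \<open>auto simp: S_def\<close>)
  then have S_left: "eventually (\<lambda>x. x \<in> S) (at_left c)"
    and S_right: "eventually (\<lambda>x. x \<in> S) (at_right c)"
    by (simp_all add: eventually_at_split)
  have lt_left: "eventually (\<lambda>x. x < c) (at_left c)"
    and gt_right: "eventually (\<lambda>x. c < x) (at_right c)"
    by (auto simp: eventually_at_filter)
  have "fh ` S \<subseteq> {a..b}" using inv SI by auto
  then have bd: "bdd_below (fh ` S)" "bdd_above (fh ` S)"
    using bdd_below_mono[of "{a..b}"] bdd_above_mono[of "{a..b}"] by auto
  obtain q where q: "(fh \<longlongrightarrow> q) (at_left c)" "\<And>x. x \<in> S \<Longrightarrow> x < c \<Longrightarrow> q < fh x"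
    using strict_antimono_on_left_limit[OF anti S_left bd(1)] by blast
  obtain p where p: "(fh \<longlongrightarrow> p) (at_right c)" "\<And>x. x \<in> S \<Longrightarrow> c < x \<Longrightarrow> fh x < p"
    using strict_antimono_on_right_limit[OF anti S_right bd(2)] by blast
  have [simp]: "Lim (at_left c) fh = q" "Lim (at_right c) fh = p"
    by (auto intro!: tendsto_Lim p q)
  have pq: "p < c" "c < q" and fc: "f c = {p..q}" using assms(16,18) by auto

  \<comment> \<open>One-sided limits at \<open>c\<close> of the iterate of order
    \<open>k\<close>\<close>
  have "F c \<noteq> {}" using multF c by (auto simp: multifun_on_def)
  then obtain m M where mM: "F c = {m..M}" "m \<le> M"
    using connected_compact_interval_1[of "F c"] assms(9,10) is_interval_connected_1[of "F c"] by auto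
  have decF: "\<And>x y u v. x \<in> I \<Longrightarrow> y \<in> I \<Longrightarrow> x < y \<Longrightarrow> u \<in> F x \<Longrightarrow> v \<in> F y \<Longrightarrow> v < u"
    using assms(6) unfolding mf_strict_dec_on_def is_max_def is_min_def
    by (meson le_less_trans less_le_trans)
  have uscFc: "eventually (\<lambda>x. F x \<subseteq> V) (at c)" if V: "open V" "F c \<subseteq> V" for V
  proof -
    obtain U where U: "open U" "c \<in> U" "\<forall>x\<in>U \<inter> I. F x \<subseteq> V"
      using uscF V c unfolding usc_on_def by blast
    have "eventually (\<lambda>x. x \<in> U) (at c)" using U eventually_at_topological by blast
    then show ?thesis using S_ev by eventually_elim (use U in \<open>auto simp: S_def\<close>)
  qed
  \<comment> \<open>Strict decrease of \<open>F\<close> keeps the values left of \<open>c\<close>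
    above \<open>M\<close>; upper semi-continuity at \<open>c\<close> keeps them below any
    \<open>e > M\<close>.\<close>
  have limM: "((\<lambda>x. (fh ^^ k) x) \<longlongrightarrow> M) (at_left c)"
  proof (rule order_tendstoI)
    fix e assume e: "e < M"
    show "eventually (\<lambda>x. e < (fh ^^ k) x) (at_left c)"
      using S_left lt_left
    proof eventually_elim
      case (elim x)
      then show ?case using decF[of x c "(fh ^^ k) x" M] FS[of x] mM e c by (auto simp: S_def)
    qed
  next
    fix e assume e: "M < e"
    have "eventually (\<lambda>x. F x \<subseteq> {..<e}) (at_left c)"
      using uscFc[OF open_lessThan, of e] mM e by (simp add: eventually_at_split subset_iff)
    then show "eventually (\<lambda>x. (fh ^^ k) x < e) (at_left c)"
      using S_left by eventually_elim (use FS in auto)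
  qed
  have limm: "((\<lambda>x. (fh ^^ k) x) \<longlongrightarrow> m) (at_right c)"
  proof (rule order_tendstoI)
    fix e assume e: "m < e"
    show "eventually (\<lambda>x. (fh ^^ k) x < e) (at_right c)"
      using S_right gt_right
    proof eventually_elim
      case (elim x)
      then show ?case using decF[of c x m "(fh ^^ k) x"] FS[of x] mM e c by (auto simp: S_def)
    qed
  next
    fix e assume e: "e < m"
    have "eventually (\<lambda>x. F x \<subseteq> {e<..}) (at_right c)"
      using uscFc[OF open_greaterThan, of e] mM e by (simp add: eventually_at_split subset_iff)
    then show "eventually (\<lambda>x. e < (fh ^^ k) x) (at_right c)"
      using S_right by eventually_elim (use FS in auto)
  qed

  \<comment> \<open>The jump of \<open>f\<close> lies inside \<open>F c\<close>\<close>
  obtain n where n: "k = Suc (2 * n)" using assms(12) by (elim oddE) auto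
  \<comment> \<open>Oddness enters here: \<open>fh\<close> sends points beyond \<open>q\<close>
    below \<open>p\<close> and points below \<open>p\<close> beyond \<open>q\<close>, so two further
    applications preserve the side reached after the first.\<close>
  have side: "(x < c \<longrightarrow> q < (fh ^^ Suc (2 * i)) x) \<and> (c < x \<longrightarrow> (fh ^^ Suc (2 * i)) x < p)"
    if x: "x \<in> S" for x i
  proof (induction i)
    case 0
    then show ?case using p q x by auto
  next
    case (Suc i)
    define y where "y = (fh ^^ Suc (2 * i)) x"
    have y: "y \<in> S" "fh y \<in> S" using iterS[OF x, of "Suc (2 * i)"] inv by (auto simp: y_def)
    have "(fh ^^ Suc (2 * Suc i)) x = fh (fh y)" by (simp add: y_def)
    moreover have "q < fh (fh y)" if "q < y" using p(2)[OF y(1)] q(2)[OF y(2)] pq that by auto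
    moreover have "fh (fh y) < p" if "y < p" using q(2)[OF y(1)] p(2)[OF y(2)] pq that by auto
    ultimately show ?case using Suc by (metis y_def)
  qed
  have qM: "q \<le> M"
  proof (rule tendsto_lowerbound[OF limM _ trivial_limit_at_left_real])
    show "eventually (\<lambda>x. q \<le> (fh ^^ k) x) (at_left c)"
      using S_left lt_left by eventually_elim (use side[of _ n] n in force)
  qed
  have mp: "m \<le> p"
  proof (rule tendsto_upperbound[OF limm _ trivial_limit_at_right_real])
    show "eventually (\<lambda>x. (fh ^^ k) x \<le> p) (at_right c)"
      using S_right gt_right by eventually_elim (use side[of _ n] n in force)
  qed
  have "F c \<subseteq> I" using multF c by (auto simp: multifun_on_def)
  \<comment> \<open>This excludes a jump of \<open>F\<close> at \<open>p\<close> or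
    \<open>q\<close>, since both lie in \<open>{m..M}\<close> and differ from
    \<open>c\<close>.\<close>
  then have FcS: "{m..M} - {c} \<subseteq> S" using assms(8) mM by (auto simp: S_def)
  then have pS: "p \<in> S" and qS: "q \<in> S" using pq qM mp by auto

  \<comment> \<open>The iterates of \<open>f\<close> at \<open>c\<close>\<close>
  note contn = continuous_on_funpow[OF cont, of "2 * n"]
  have fhk: "(fh ^^ k) x = (fh ^^ (2 * n)) (fh x)" for x
    by (simp add: n funpow_swap1)
  \<comment> \<open>One application of \<open>fh\<close> tends to \<open>q\<close> from the left of
    \<open>c\<close>; the remaining \<open>2 * n\<close> are continuous at \<open>q\<close>, because
    \<open>q\<close> lies in \<open>S\<close>. Uniqueness of limits then identifies the
    value.\<close>
  have Meq: "(fh ^^ (2 * n)) q = M"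
  proof (rule tendsto_unique[OF trivial_limit_at_left_real _ limM])
    show "((\<lambda>x. (fh ^^ k) x) \<longlongrightarrow> (fh ^^ (2 * n)) q) (at_left c)"
      unfolding fhk
      by (rule continuous_on_tendsto_compose[OF conjunct1[OF contn] q(1) qS])
        (use S_left inv in \<open>auto elim: eventually_mono\<close>)
  qed
  have meq: "(fh ^^ (2 * n)) p = m"
  proof (rule tendsto_unique[OF trivial_limit_at_right_real _ limm])
    show "((\<lambda>x. (fh ^^ k) x) \<longlongrightarrow> (fh ^^ (2 * n)) p) (at_right c)"
      unfolding fhk
      by (rule continuous_on_tendsto_compose[OF conjunct1[OF contn] p(1) pS])
        (use S_right inv in \<open>auto elim: eventually_mono\<close>)
  qed

  \<comment> \<open>\<open>u i\<close> and \<open>v i\<close> are to be the endpoints of the iterate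
    of order \<open>Suc i\<close> at \<open>c\<close>. The decreasing \<open>fh\<close> swaps left
    and right endpoints at each application, hence the parity.\<close>
  define u where "u i = (fh ^^ i) (if even i then p else q)" for i
  define v where "v i = (fh ^^ i) (if even i then q else p)" for i
  have uSuc: "u (Suc i) = fh (v i)" and vSuc: "v (Suc i) = fh (u i)" for i
    by (auto simp: u_def v_def)
  have uS: "u i \<in> S" and vS: "v i \<in> S" for i
    using iterS[OF pS] iterS[OF qS] by (auto simp: u_def v_def)
  \<comment> \<open>The intervals grow: at the start because \<open>q\<close> and \<open>p\<close>
    lie on opposite sides of \<open>c\<close>, afterwards because \<open>fh\<close> reverses both
    inequalities.\<close>
  have step: "u (Suc i) < u i \<and> v i < v (Suc i)" for i
  proof (induction i)
    case 0
    then show ?case using p(2)[OF qS] q(2)[OF pS] pq by (auto simp: u_def v_def)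
  next
    case (Suc i)
    then show ?case
      using monotone_onD[OF anti uS uS, of "Suc i" i] monotone_onD[OF anti vS vS, of i "Suc i"]
      by (auto simp: uSuc vSuc)
  qed
  have u_le: "u j \<le> u i" and v_le: "v i \<le> v j" if "i \<le> j" for i j
    using lift_Suc_antimono_le[of u i j] lift_Suc_mono_le[of v i j] step that
    by (auto simp: less_imp_le)
  \<comment> \<open>Up to index \<open>2 * n\<close> the growing intervals stay within
    \<open>{m..M}\<close>, so they meet no jump but \<open>c\<close> and the image lemma applies. At
    \<open>2 * n\<close> the order is \<open>k\<close> and the interval is
    \<open>F c\<close>.\<close>
  have iterc: "mf_iter f (Suc i) c = {u i..v i}" if "i \<le> 2 * n" for i
    using that
  proof (induction i)
    case 0
    then show ?case by (simp add: fc u_def v_def)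
  next
    case (Suc i)
    have "u (2 * n) = m" "v (2 * n) = M" by (auto simp: u_def v_def meq Meq)
    then have "m \<le> u i" "v i \<le> M" using u_le[of i "2 * n"] v_le[of i "2 * n"] Suc.prems by auto
    then have sub: "{u i..v i} - {c} \<subseteq> S" using FcS by (auto simp: subset_iff)
    have uc: "u i < c" and vc: "c < v i"
      using u_le[of 0 i] v_le[of 0 i] pq by (auto simp: u_def v_def)
    have "mf_iter f (Suc (Suc i)) c = (\<Union>y\<in>{u i..v i}. f y)" using Suc by (simp only: mf_iter.simps)
    also have "\<dots> = {fh (v i)..fh (u i)}"
      by (rule decreasing_filled_jump_image[OF sub uc vc anti cont q p _ fS c(3) fc])
        (use pq in auto)
    finally show ?case by (simp only: uSuc vSuc)
  qed
  have "mf_iter f k c = F c"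
    using iterc[of "2 * n"] by (simp only: n mM) (simp add: u_def v_def meq Meq)
  moreover have "{p..q} \<subseteq> {m..M}" using qM mp by auto
  then have "f c \<noteq> {}" "f c \<subseteq> insert c S"
    unfolding fc using pq FcS by (simp, blast)
  ultimately have root: "iter_root_on (S \<union> {c}) k F f"
    using iterS FS fS inv by (auto simp: iter_root_on_def multifun_on_def)

  \<comment> \<open>Monotonicity and upper semi-continuity of \<open>f\<close>\<close>
  have dec: "mf_strict_dec_on (S \<union> {c}) f"
    unfolding mf_strict_dec_on_def
  proof (intro ballI impI)
    fix x y assume xy: "x \<in> S \<union> {c}" "y \<in> S \<union> {c}" "x < y"
    consider "x \<in> S" "y \<in> S" | "x \<in> S" "y = c" | "x = c" "y \<in> S" using xy by auto
    then show "\<exists>m M. is_min (f x) m \<and> is_max (f y) M \<and> m > M"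
    proof cases
      case 1
      then show ?thesis using fS monotone_onD[OF anti 1 xy(3)] by (auto simp: is_min_def is_max_def)
    next
      case 2
      then show ?thesis using fS[OF 2(1)] fc q(2)[OF 2(1)] xy pq
        by (intro exI[of _ "fh x"] exI[of _ q]) (auto simp: is_min_def is_max_def)
    next
      case 3
      then show ?thesis using fS[OF 3(2)] fc p(2)[OF 3(2)] xy pq
        by (intro exI[of _ p] exI[of _ "fh y"]) (auto simp: is_min_def is_max_def)
    qed
  qed

  have usc: "usc_on (S \<union> {c}) f"
    unfolding usc_on_def
  proof (intro ballI allI impI)
    fix x0 V assume x0: "x0 \<in> S \<union> {c}" and V: "open V \<and> f x0 \<subseteq> V"
    show "\<exists>U. open U \<and> x0 \<in> U \<and> (\<forall>x\<in>U \<inter> (S \<union> {c}). f x \<subseteq> V)"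
    proof (cases "x0 = c")
      case True
      \<comment> \<open>At \<open>c\<close> it suffices that \<open>V\<close> contains both
        one-sided limits of \<open>fh\<close>, the values near \<open>c\<close> being single
        points.\<close>
      then have "p \<in> V" "q \<in> V" using V fc pq by auto
      then have "eventually (\<lambda>x. fh x \<in> V) (at c)"
        using topological_tendstoD[OF q(1)] topological_tendstoD[OF p(1)] V
        by (auto simp: eventually_at_split)
      then obtain U where "open U" "c \<in> U" "\<forall>x\<in>U. x \<noteq> c \<longrightarrow> fh x \<in> V"
        by (auto simp: eventually_at_topological)
      then show ?thesis using True V fS by (intro exI[of _ U]) auto
    next
      case False
      then have x0S: "x0 \<in> S" using x0 by auto
      then have "fh x0 \<in> V" using V fS by auto
      then obtain U where U: "open U" "x0 \<in> U" "\<forall>x\<in>S. x \<in> U \<longrightarrow> fh x \<in> V"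
        using cont x0S V unfolding continuous_on_topological by meson
      \<comment> \<open>Removing \<open>c\<close> keeps the neighbourhood open and leaves only
        points where \<open>f\<close> is single-valued.\<close>
      then show ?thesis using False fS by (intro exI[of _ "U - {c}"]) auto
    qed
  qed
  show ?thesis using dec usc root by (simp add: S_def)
qed

end
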